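(* Let $R$ be a convex quadrilateral in the $xy$-plane which is not a parallelogram. Suppose that $E_1$ and $E_2$ are each ellipses, with $E_1$ inscribed in $R$ and $E_2$ circumscribed about $R$. Then $E_1$ and $E_2$ cannot have the same center.
   Context: Ellipses are nondegenerate and include circles. An ellipse is inscribed in $R$ if it lies in $R$ and is tangent to each of the four sides of $R$. An ellipse is circumscribed about $R$ if it passes through the four vertices of $R$. *)

theory Defs
  imports "HOL-Analysis.Analysis"
begin

(* An ellipse is a curve (not the region it bounds): the locus with semi-axes a, b along the
   orthonormal directions u, v. Circles are the case a = b. *)
definition ellipse_centered_at :: "real^2 \<Rightarrow> (real^2) set \<Rightarrow> bool" where
  "ellipse_centered_at c E \<longleftrightarrow>
     (\<exists>u v a b. norm u = 1 \<and> norm v = 1 \<and> u \<bullet> v = 0 \<and> a > 0 \<and> b > 0 \<and>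
        E = {p. ((p - c) \<bullet> u)\<^sup>2 / a\<^sup>2 + ((p - c) \<bullet> v)\<^sup>2 / b\<^sup>2 = 1})"

definition is_ellipse :: "(real^2) set \<Rightarrow> bool" where
  "is_ellipse E \<longleftrightarrow> (\<exists>c. ellipse_centered_at c E)"

definition ellipse_center :: "(real^2) set \<Rightarrow> real^2" where
  "ellipse_center E = (THE c. ellipse_centered_at c E)"

lemma ellipse_centered_at_reflect:
  assumes "ellipse_centered_at c E" "p \<in> E"
  shows "2 *\<^sub>R c - p \<in> E"
proof -
  have "2 *\<^sub>R c - p - c = - (p - c)"
    unfolding scaleR_2 by simp
  then have "((2 *\<^sub>R c - p - c) \<bullet> w)\<^sup>2 = ((p - c) \<bullet> w)\<^sup>2" for w
    by (simp only: inner_minus_left power2_minus)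
  then show ?thesis
    using assms unfolding ellipse_centered_at_def by fastforce
qed

lemma ellipse_centered_at_unique:
  assumes c: "ellipse_centered_at c E" and c': "ellipse_centered_at c' E"
  shows "c' = c"
proof -
  obtain u v a b where uv: "norm u = 1" "norm v = 1" "u \<bullet> v = 0" and ab: "a > 0" "b > 0"
    and E: "E = {p. ((p - c) \<bullet> u)\<^sup>2 / a\<^sup>2 + ((p - c) \<bullet> v)\<^sup>2 / b\<^sup>2 = 1}"
    using c unfolding ellipse_centered_at_def by blast
  define d where "d = c' - c"
  have step: "p + 2 *\<^sub>R d \<in> E" if "p \<in> E" for p
  proof -
    have "2 *\<^sub>R c' - (2 *\<^sub>R c - p) \<in> E"
      using that c c' ellipse_centered_at_reflect by blast
    then show ?thesis by (simp add: d_def algebra_simps)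
  qed
  have translates: "p + (2 * real n) *\<^sub>R d \<in> E" if "p \<in> E" for p n
  proof (induction n)
    case 0
    then show ?case using that by simp
  next
    case (Suc n)
    have "p + (2 * real (Suc n)) *\<^sub>R d = p + (2 * real n) *\<^sub>R d + 2 *\<^sub>R d"
      by (simp add: algebra_simps)
    then show ?case using step[OF Suc] by (simp only:)
  qed
  have uu: "u \<bullet> u = 1" "v \<bullet> v = 1"
    using uv by (simp_all add: norm_eq_1)
  have p: "c + a *\<^sub>R u \<in> E"
    using ab uv(3) uu by (simp add: E inner_commute)
  have bound: "\<bar>(q - c) \<bullet> u\<bar> \<le> a" "\<bar>(q - c) \<bullet> v\<bar> \<le> b" if "q \<in> E" for q
  proof -
    have 1: "((q - c) \<bullet> u)\<^sup>2 / a\<^sup>2 + ((q - c) \<bullet> v)\<^sup>2 / b\<^sup>2 = 1"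
      using that E by simp
    moreover have "((q - c) \<bullet> u)\<^sup>2 / a\<^sup>2 \<ge> 0" "((q - c) \<bullet> v)\<^sup>2 / b\<^sup>2 \<ge> 0"
      by simp_all
    ultimately have "((q - c) \<bullet> u)\<^sup>2 / a\<^sup>2 \<le> 1" "((q - c) \<bullet> v)\<^sup>2 / b\<^sup>2 \<le> 1"
      by linarith+
    then have "((q - c) \<bullet> u)\<^sup>2 \<le> a\<^sup>2" "((q - c) \<bullet> v)\<^sup>2 \<le> b\<^sup>2"
      using ab by (simp_all add: divide_le_eq)
    then show "\<bar>(q - c) \<bullet> u\<bar> \<le> a" "\<bar>(q - c) \<bullet> v\<bar> \<le> b"
      using ab abs_le_square_iff[of _ a] abs_le_square_iff[of _ b] by auto
  qed
  have zero: "x = 0" if "\<And>n. \<bar>y + 2 * real n * x\<bar> \<le> k" for x y k :: real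
  proof (rule ccontr)
    assume "x \<noteq> 0"
    then obtain n :: nat where n: "\<bar>k\<bar> + \<bar>y\<bar> < real n * \<bar>x\<bar>"
      using reals_Archimedean3[of "\<bar>x\<bar>"] by auto
    have "\<bar>2 * real n * x\<bar> \<le> \<bar>k\<bar> + \<bar>y\<bar>"
      using that[of n] by linarith
    then have "2 * (real n * \<bar>x\<bar>) \<le> \<bar>k\<bar> + \<bar>y\<bar>"
      by (simp add: abs_mult)
    then show False using n by linarith
  qed
  have "d \<bullet> u = 0"
    using bound(1)[OF translates[OF p]] uu
    by (intro zero[where y = a and k = a]) (simp add: inner_add_left)
  moreover have "d \<bullet> v = 0"
    using bound(2)[OF translates[OF p]] uv(3)
    by (intro zero[where y = 0 and k = b]) (simp add: inner_add_left)
  moreover have "d = (d \<bullet> u) *\<^sub>R u + (d \<bullet> v) *\<^sub>R v"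
  proof -
    have "u \<noteq> v" using uv(3) uu by auto
    have "independent {u, v}"
      using uv uu by (intro pairwise_orthogonal_independent)
        (auto simp: pairwise_def orthogonal_def inner_commute)
    then have "UNIV \<subseteq> span {u, v}"
      using \<open>u \<noteq> v\<close> by (intro card_ge_dim_independent) auto
    then have "d \<in> span {u, v}" by blast
    then obtain s t where "d = s *\<^sub>R u + t *\<^sub>R v"
      by (auto simp: span_breakdown_eq algebra_simps)
    then show ?thesis
      using uv(3) uu by (simp add: inner_add_left inner_add_right inner_commute)
  qed
  ultimately have "d = 0" by simp
  then show ?thesis by (simp add: d_def)
qed

lemma ellipse_center_eqI: "ellipse_centered_at c E \<Longrightarrow> ellipse_center E = c"
  unfolding ellipse_center_def by (blast intro: ellipse_centered_at_unique)

(* The quadrilateral with vertices A, B, C, D in cyclic order. The endpoints of an edge are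
   extreme points, so no angle of the quadrilateral is straight. *)
definition convex_quadrilateral :: "real^2 \<Rightarrow> real^2 \<Rightarrow> real^2 \<Rightarrow> real^2 \<Rightarrow> bool" where
  "convex_quadrilateral A B C D \<longleftrightarrow>
     distinct [A, B, C, D] \<and>
     (\<forall>(P, Q) \<in> {(A, B), (B, C), (C, D), (D, A)}.
        closed_segment P Q edge_of convex hull {A, B, C, D})"

definition parallel_vectors :: "real^2 \<Rightarrow> real^2 \<Rightarrow> bool" where
  "parallel_vectors u v \<longleftrightarrow> collinear {0, u, v}"

definition parallelogram :: "real^2 \<Rightarrow> real^2 \<Rightarrow> real^2 \<Rightarrow> real^2 \<Rightarrow> bool" where
  "parallelogram A B C D \<longleftrightarrow>
     convex_quadrilateral A B C D \<and>
     parallel_vectors (B - A) (D - C) \<and> parallel_vectors (C - B) (A - D)"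

definition tangent_line_at :: "(real^2) set \<Rightarrow> (real^2) set \<Rightarrow> real^2 \<Rightarrow> bool" where
  "tangent_line_at L E p \<longleftrightarrow>
     (\<exists>\<gamma> w. (\<forall>t::real. \<gamma> t \<in> E) \<and> \<gamma> 0 = p \<and> (\<gamma> has_vector_derivative w) (at 0) \<and> w \<noteq> 0 \<and>
        L = {p + s *\<^sub>R w | s. True})"

(* The point of tangency has to lie on the side itself, not merely on the line through it. *)
definition tangent_to_side :: "(real^2) set \<Rightarrow> real^2 \<Rightarrow> real^2 \<Rightarrow> bool" where
  "tangent_to_side E P Q \<longleftrightarrow>
     (\<exists>p \<in> closed_segment P Q. tangent_line_at (affine hull {P, Q}) E p)"

definition inscribed :: "(real^2) set \<Rightarrow> real^2 \<Rightarrow> real^2 \<Rightarrow> real^2 \<Rightarrow> real^2 \<Rightarrow> bool" where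
  "inscribed E A B C D \<longleftrightarrow>
     E \<subseteq> convex hull {A, B, C, D} \<and>
     tangent_to_side E A B \<and> tangent_to_side E B C \<and>
     tangent_to_side E C D \<and> tangent_to_side E D A"

definition circumscribed :: "(real^2) set \<Rightarrow> real^2 \<Rightarrow> real^2 \<Rightarrow> real^2 \<Rightarrow> real^2 \<Rightarrow> bool" where
  "circumscribed E A B C D \<longleftrightarrow> {A, B, C, D} \<subseteq> E"

end

theory Submission
  imports Defs
begin

text \<open>
  Suppose the two ellipses share the centre \<open>O\<close>. Take \<open>O\<close> as the origin and apply the linear map
  that turns \<open>E2\<close> into the unit circle. The vertices become unit vectors \<open>a, b, c, d\<close>, and \<open>E1\<close>
  becomes the curve \<open>\<Phi>(x, x) = 1\<close> of a positive definite symmetric form \<open>\<Phi>\<close>, lying in the unit disc.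

  The key point is that, for distinct unit vectors \<open>x, y\<close>, tangency of the chord \<open>xy\<close> to
  \<open>\<Phi> = 1\<close> is a \<^emph>\<open>bilinear\<close> condition. In general it is quadratic in each endpoint, but on the
  circle it contains the factor \<open>1 - x \<bullet> y\<close>, which does not vanish and cancels. What is left is
  \<open>2 \<Phi>(x, y) = m (1 + x \<bullet> y)\<close> with \<open>m = tr \<Phi> - det \<Phi>\<close>
  (lemma \<open>chord_tangency_bilinear\<close>). With the form \<open>\<beta>(x, y) = 2 \<Phi>(x, y) - m (x \<bullet> y)\<close>, every side
  of the quadrilateral therefore satisfies \<open>\<beta> = m\<close>.

  Comparing the sides at \<open>a\<close> and at \<open>c\<close> gives \<open>\<beta>(a, b - d) = 0 = \<beta>(c, b - d)\<close>. Since \<open>\<Phi> = 1\<close>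
  lies in the unit disc, \<open>\<beta>\<close> is nondegenerate (lemma \<open>discriminant_positive\<close>), so \<open>a\<close> and \<open>c\<close> are
  linearly dependent; being distinct unit vectors they are antipodal. In the same way \<open>b\<close> and \<open>d\<close>
  are antipodal. Hence the diagonals bisect each other at \<open>O\<close> and the quadrilateral is a
  parallelogram.
\<close>

section \<open>Ellipses as preimages of the unit circle\<close>

lemma inner_real2: "(x::real^2) \<bullet> y = x$1 * y$1 + x$2 * y$2"
  by (simp add: inner_vec_def sum_2)

lemma norm_eq_1_real2: "norm (x::real^2) = 1 \<longleftrightarrow> (x$1)\<^sup>2 + (x$2)\<^sup>2 = 1"
  by (simp add: norm_eq_1 inner_real2 power2_eq_square)

lemma ellipse_linear_preimage_circle:
  assumes "ellipse_centered_at c E"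
  obtains f :: "real^2 \<Rightarrow> real^2" where "linear f" "inj f" "E = {p. norm (f (p - c)) = 1}"
proof -
  obtain u v a b where uv: "norm u = 1" "norm v = 1" "u \<bullet> v = 0" and ab: "a > 0" "b > 0"
    and E: "E = {p. ((p - c) \<bullet> u)\<^sup>2 / a\<^sup>2 + ((p - c) \<bullet> v)\<^sup>2 / b\<^sup>2 = 1}"
    using assms unfolding ellipse_centered_at_def by blast
  define f :: "real^2 \<Rightarrow> real^2" where "f p = vector [(p \<bullet> u) / a, (p \<bullet> v) / b]" for p
  have lin: "linear f"
    by (rule linearI)
      (simp_all add: f_def vec_eq_iff forall_2 inner_add_left add_divide_distrib)
  have "(u$1 * v$2 - u$2 * v$1)\<^sup>2 = 1"
    using uv unfolding norm_eq_1_real2 inner_real2 by algebra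
  then have det: "u$1 * v$2 - u$2 * v$1 \<noteq> 0"
    by auto
  have "inj f"
    unfolding linear_injective_0[OF lin]
  proof (intro allI impI)
    fix p assume "f p = 0"
    then have "p$1 * u$1 + p$2 * u$2 = 0" "p$1 * v$1 + p$2 * v$2 = 0"
      using ab by (simp_all add: f_def vec_eq_iff forall_2 inner_real2)
    then have "(u$1 * v$2 - u$2 * v$1) * p$1 = 0" "(u$1 * v$2 - u$2 * v$1) * p$2 = 0"
      by algebra+
    then show "p = 0"
      using det by (simp add: vec_eq_iff forall_2)
  qed
  moreover have "E = {p. norm (f (p - c)) = 1}"
    by (simp add: E norm_eq_1_real2 f_def power_divide)
  ultimately show thesis
    using lin that by blast
qed

text \<open>Differentiating the constant \<open>norm (f (\<gamma> t - c))\<^sup>2 = 1\<close> along the curve \<open>\<gamma>\<close> that defines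
  the tangent makes its direction conjugate to the radius to the point of contact.\<close>

lemma tangent_direction_conjugate:
  fixes f :: "real^2 \<Rightarrow> real^2"
  assumes "linear f" and E: "E = {p. norm (f (p - c)) = 1}" and "tangent_line_at L E p"
  obtains w where "L = {p + s *\<^sub>R w | s. True}" "norm (f (p - c)) = 1" "f (p - c) \<bullet> f w = 0"
proof -
  obtain \<gamma> w where g: "\<And>t::real. \<gamma> t \<in> E" "\<gamma> 0 = p" "(\<gamma> has_vector_derivative w) (at 0)"
    and L: "L = {p + s *\<^sub>R w | s. True}"
    using assms(3) unfolding tangent_line_at_def by blast
  have "((\<lambda>t. \<gamma> t - c) has_vector_derivative w - 0) (at 0)"
    by (intro derivative_intros g(3))
  then have d: "((\<lambda>t. f (\<gamma> t - c)) has_vector_derivative f w) (at 0)"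
    using bounded_linear.has_vector_derivative[OF linear_linear[THEN iffD2, OF assms(1)]]
    by fastforce
  have "((\<lambda>t. f (\<gamma> t - c) \<bullet> f (\<gamma> t - c)) has_vector_derivative
      f (p - c) \<bullet> f w + f w \<bullet> f (p - c)) (at 0)"
    using bounded_bilinear.has_vector_derivative[OF bounded_bilinear_inner d d]
    by (simp add: g(2))
  moreover have "(\<lambda>t. f (\<gamma> t - c) \<bullet> f (\<gamma> t - c)) = (\<lambda>t. 1)"
    using g(1) by (simp add: E norm_eq_1)
  ultimately have "f (p - c) \<bullet> f w + f w \<bullet> f (p - c) = 0"
    using vector_derivative_unique_at has_vector_derivative_const by metis
  then have "f (p - c) \<bullet> f w = 0"
    by (simp add: inner_commute)
  moreover have "norm (f (p - c)) = 1"
    using g(1)[of 0] g(2) E by simp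
  ultimately show thesis
    using L that by blast
qed

section \<open>Symmetric forms on the plane\<close>

text \<open>The form with matrix \<open>((s, r), (r, t))\<close>.\<close>

definition sym_form :: "real \<Rightarrow> real \<Rightarrow> real \<Rightarrow> real^2 \<Rightarrow> real^2 \<Rightarrow> real" where
  "sym_form s r t x y = s * x$1 * y$1 + r * (x$1 * y$2 + x$2 * y$1) + t * x$2 * y$2"

lemma linear_pullback_inner_sym_form:
  fixes k :: "real^2 \<Rightarrow> real^2"
  assumes "linear k"
  obtains s r t where "\<And>x y. k x \<bullet> k y = sym_form s r t x y"
proof -
  define e1 e2 :: "real^2" where "e1 = vector [1, 0]" and "e2 = vector [0, 1]"
  have k: "k x = x$1 *\<^sub>R k e1 + x$2 *\<^sub>R k e2" for x
  proof -
    have "x = x$1 *\<^sub>R e1 + x$2 *\<^sub>R e2"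
      by (simp add: e1_def e2_def vec_eq_iff forall_2)
    then have "k x = k (x$1 *\<^sub>R e1 + x$2 *\<^sub>R e2)"
      by simp
    then show ?thesis
      by (simp add: linear_add[OF assms] linear_scale[OF assms])
  qed
  have "k x \<bullet> k y = sym_form (k e1 \<bullet> k e1) (k e1 \<bullet> k e2) (k e2 \<bullet> k e2) x y" for x y
    by (subst k[of x], subst k[of y])
      (simp add: sym_form_def inner_add_left inner_add_right inner_commute algebra_simps)
  then show thesis
    using that by blast
qed

text \<open>This is \<open>det (2 \<Phi> - m I) > 0\<close> for \<open>m = tr \<Phi> - det \<Phi>\<close>. In terms of the eigenvalues
  \<open>\<lambda>, \<mu>\<close> of \<open>\<Phi>\<close>, which are at least \<open>1\<close> by hypothesis, the determinant is
  \<open>(\<lambda> \<mu>)\<^sup>2 - (\<lambda> - \<mu>)\<^sup>2\<close>, and \<open>\<bar>\<lambda> - \<mu>\<bar> < max \<lambda> \<mu> \<le> \<lambda> \<mu>\<close>. The proof avoids diagonalising: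
  \<open>(\<lambda> - 1) (\<mu> - 1) \<ge> 0\<close> bounds the trace by the determinant.\<close>

lemma discriminant_positive:
  assumes "\<And>x. x \<bullet> x \<le> sym_form s r t x x"
  shows "(2 * s - (s + t - (s * t - r\<^sup>2))) * (2 * t - (s + t - (s * t - r\<^sup>2))) - (2 * r)\<^sup>2 > 0"
proof -
  define D where "D = s * t - r\<^sup>2"
  have form: "0 \<le> (s - 1) * a\<^sup>2 + 2 * r * a * b + (t - 1) * b\<^sup>2" for a b
    using assms[of "vector [a, b]"]
    by (simp add: inner_real2 sym_form_def algebra_simps power2_eq_square)
  have s: "s \<ge> 1" and t: "t \<ge> 1"
    using form[of 1 0] form[of 0 1] by simp_all
  have det: "(s - 1) * (t - 1) - r\<^sup>2 \<ge> 0"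
  proof (cases "s = 1")
    case True
    \<comment> \<open>Without a square term in \<open>a\<close>, the form is affine in \<open>a\<close> and unbounded below unless \<open>r = 0\<close>.\<close>
    have "r = 0"
    proof (rule ccontr)
      assume "r \<noteq> 0"
      then show False
        using form[of "- t / (2 * r)" 1] True by simp
    qed
    then show ?thesis
      using True by simp
  next
    case False
    have "0 \<le> (s - 1) * ((s - 1) * (t - 1) - r\<^sup>2)"
      using form[of r "- (s - 1)"] by (simp add: algebra_simps power2_eq_square)
    then show ?thesis
      using False s by (simp add: zero_le_mult_iff)
  qed
  then have "s + t \<le> D + 1"
    by (simp add: D_def algebra_simps)
  then have "(s + t)\<^sup>2 \<le> (D + 1)\<^sup>2" and "D \<ge> 1"
    using s t by (auto intro: power_mono)
  then have "D\<^sup>2 + 4 * D - (s + t)\<^sup>2 > 0"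
    by (simp add: power2_eq_square algebra_simps)
  moreover have "(2 * s - (s + t - D)) * (2 * t - (s + t - D)) - (2 * r)\<^sup>2 = D\<^sup>2 + 4 * D - (s + t)\<^sup>2"
    unfolding D_def by algebra
  ultimately show ?thesis
    by (simp add: D_def)
qed

section \<open>Tangent chords of the unit circle\<close>

text \<open>The line through \<open>x\<close> and \<open>y\<close> touches \<open>\<Phi> = 1\<close> at \<open>p\<close> in the conjugate direction \<open>w\<close>, so
  Lagrange's identity \<open>det \<Phi> (det (p, w))\<^sup>2 = \<Phi>(p, p) \<Phi>(w, w) - \<Phi>(p, w)\<^sup>2\<close> turns into
  \<open>det \<Phi> (det (x, y))\<^sup>2 = \<Phi>(y - x, y - x)\<close>. For unit vectors both sides are divisible by
  \<open>1 - x \<bullet> y\<close>.\<close>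

lemma chord_tangency_bilinear:
  assumes unit: "norm x = 1" "norm y = 1" and "x \<noteq> y"
    and tangent: "sym_form s r t p p = 1" "sym_form s r t p w = 0"
    and xy: "x = p + \<sigma> *\<^sub>R w" "y = p + \<tau> *\<^sub>R w"
  shows "2 * sym_form s r t x y = (s + t - (s * t - r\<^sup>2)) * (1 + x \<bullet> y)"
proof -
  have "(s * t - r\<^sup>2) * (p$1 * w$2 - p$2 * w$1)\<^sup>2
      = sym_form s r t p p * sym_form s r t w w - (sym_form s r t p w)\<^sup>2"
    unfolding sym_form_def by algebra
  then have pw: "(s * t - r\<^sup>2) * (p$1 * w$2 - p$2 * w$1)\<^sup>2 = sym_form s r t w w"
    by (simp add: tangent)
  have "x$1 * y$2 - x$2 * y$1 = (\<tau> - \<sigma>) * (p$1 * w$2 - p$2 * w$1)"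
    by (simp add: xy algebra_simps)
  moreover have "sym_form s r t (y - x) (y - x) = (\<tau> - \<sigma>)\<^sup>2 * sym_form s r t w w"
    by (simp add: xy sym_form_def algebra_simps power2_eq_square)
  ultimately have 1: "(s * t - r\<^sup>2) * (x$1 * y$2 - x$2 * y$1)\<^sup>2 = sym_form s r t (y - x) (y - x)"
    by (simp add: pw[symmetric] power_mult_distrib)
  have 2: "(x$1 * y$2 - x$2 * y$1)\<^sup>2 = (1 - x \<bullet> y) * (1 + x \<bullet> y)"
    using unit unfolding norm_eq_1_real2 inner_real2 by algebra
  have 3: "sym_form s r t (y - x) (y - x)
      = (1 - x \<bullet> y) * ((s + t) * (1 + x \<bullet> y) - 2 * sym_form s r t x y)"
    using unit unfolding norm_eq_1_real2 inner_real2 sym_form_def vector_minus_component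
    by algebra
  have "(x - y) \<bullet> (x - y) = 2 * (1 - x \<bullet> y)"
    using unit by (simp add: norm_eq_1 inner_diff_left inner_diff_right inner_commute)
  then have "1 - x \<bullet> y \<noteq> 0"
    using \<open>x \<noteq> y\<close> by auto
  moreover have "(1 - x \<bullet> y) * ((s * t - r\<^sup>2) * (1 + x \<bullet> y))
      = (1 - x \<bullet> y) * ((s + t) * (1 + x \<bullet> y) - 2 * sym_form s r t x y)"
    using 1 2 3 by (simp add: mult.left_commute)
  ultimately have "(s * t - r\<^sup>2) * (1 + x \<bullet> y) = (s + t) * (1 + x \<bullet> y) - 2 * sym_form s r t x y"
    by simp
  then show ?thesis
    by (simp add: algebra_simps)
qed

text \<open>Both \<open>x\<close> and \<open>y\<close> are orthogonal to the image of \<open>z\<close> under the invertible matrix of the form,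
  a nonzero vector of the plane.\<close>

lemma nondegenerate_common_conjugate_dependent:
  assumes "s * t - r\<^sup>2 \<noteq> 0" "z \<noteq> 0" "sym_form s r t x z = 0" "sym_form s r t y z = 0"
  shows "x$1 * y$2 - x$2 * y$1 = 0"
proof (rule ccontr)
  assume det: "x$1 * y$2 - x$2 * y$1 \<noteq> 0"
  define g h where "g = s * z$1 + r * z$2" and "h = r * z$1 + t * z$2"
  have "x$1 * g + x$2 * h = 0" "y$1 * g + y$2 * h = 0"
    using assms(3,4) by (simp_all add: g_def h_def sym_form_def algebra_simps)
  then have "(x$1 * y$2 - x$2 * y$1) * g = 0" "(x$1 * y$2 - x$2 * y$1) * h = 0"
    by algebra+
  then have "g = 0" "h = 0"
    using det by simp_all
  then have "(s * t - r\<^sup>2) * z$1 = 0" "(s * t - r\<^sup>2) * z$2 = 0"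
    unfolding g_def h_def by algebra+
  then show False
    using assms(1,2) by (simp add: vec_eq_iff forall_2)
qed

lemma dependent_unit_vectors_antipodal:
  fixes x y :: "real^2"
  assumes "norm x = 1" "norm y = 1" "x \<noteq> y" "x$1 * y$2 - x$2 * y$1 = 0"
  shows "y = - x"
proof -
  have "(x \<bullet> y - 1) * (x \<bullet> y + 1) = 0"
    using assms(1,2,4) unfolding norm_eq_1_real2 inner_real2 by algebra
  moreover have "(x - y) \<bullet> (x - y) = 2 * (1 - x \<bullet> y)" "(x + y) \<bullet> (x + y) = 2 * (1 + x \<bullet> y)"
    using assms(1,2) by (simp_all add: norm_eq_1 inner_diff inner_add inner_commute)
  ultimately have "(x - y) \<bullet> (x - y) = 0 \<or> (x + y) \<bullet> (x + y) = 0"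
    by auto
  then have "x - y = 0 \<or> x + y = 0"
    by (simp only: inner_eq_zero_iff)
  then show ?thesis
    using assms(3) by (auto simp: eq_neg_iff_add_eq_0 add.commute)
qed

lemma tangent_quadrilateral_diagonal_antipodal:
  assumes disc: "\<And>x. x \<bullet> x \<le> sym_form s r t x x"
    and unit: "norm a = 1" "norm c = 1" and "a \<noteq> c" "b \<noteq> d"
    and chord: "\<And>x y. x \<in> {a, c} \<Longrightarrow> y \<in> {b, d} \<Longrightarrow>
      2 * sym_form s r t x y = (s + t - (s * t - r\<^sup>2)) * (1 + x \<bullet> y)"
  shows "c = - a"
proof -
  define m where "m = s + t - (s * t - r\<^sup>2)"
  have "sym_form (2 * s - m) (2 * r) (2 * t - m) x (b - d) = 0" if "x \<in> {a, c}" for x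
  proof -
    have "sym_form (2 * s - m) (2 * r) (2 * t - m) x (b - d)
        = (2 * sym_form s r t x b - m * (1 + x \<bullet> b)) - (2 * sym_form s r t x d - m * (1 + x \<bullet> d))"
      by (simp add: sym_form_def inner_real2 algebra_simps)
    then show ?thesis
      using chord[OF that, of b] chord[OF that, of d] by (simp add: m_def)
  qed
  moreover have "(2 * s - m) * (2 * t - m) - (2 * r)\<^sup>2 \<noteq> 0"
    using discriminant_positive[OF disc] unfolding m_def by simp
  moreover have "b - d \<noteq> 0"
    using \<open>b \<noteq> d\<close> by simp
  ultimately have "a$1 * c$2 - a$2 * c$1 = 0"
    using nondegenerate_common_conjugate_dependent[of "2 * s - m" "2 * t - m" "2 * r" "b - d" a c]
    by blast
  then show ?thesis
    using dependent_unit_vectors_antipodal unit \<open>a \<noteq> c\<close> by blast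
qed

section \<open>Concentric inscribed and circumscribed ellipses\<close>

lemma concentric_ellipses_imp_parallelogram:
  assumes quad: "convex_quadrilateral A B C D"
    and E1: "ellipse_centered_at Z E1" and E2: "ellipse_centered_at Z E2"
    and ins: "inscribed E1 A B C D" and circ: "circumscribed E2 A B C D"
  shows "parallelogram A B C D"
proof -
  obtain f :: "real^2 \<Rightarrow> real^2" where f: "linear f" "inj f"
    and E2f: "E2 = {p. norm (f (p - Z)) = 1}"
    using ellipse_linear_preimage_circle[OF E2] by blast
  obtain g :: "real^2 \<Rightarrow> real^2" where g: "linear g" "inj g"
    and E1g: "E1 = {p. norm (g (p - Z)) = 1}"
    using ellipse_linear_preimage_circle[OF E1] by blast
  obtain f' :: "real^2 \<Rightarrow> real^2" where f': "linear f'" "\<And>x. f' (f x) = x" "\<And>x. f (f' x) = x"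
    using linear_injective_isomorphism[OF f] by blast
  \<comment> \<open>The map \<open>p \<mapsto> f (p - Z)\<close> carries \<open>E2\<close> to the unit circle and \<open>E1\<close> to the curve
    \<open>norm (k x) = 1\<close>.\<close>
  define k where "k = g \<circ> f'"
  have k: "linear k"
    unfolding k_def using f'(1) g(1) by (rule linear_compose)
  obtain s r t where S: "\<And>x y. k x \<bullet> k y = sym_form s r t x y"
    using linear_pullback_inner_sym_form[OF k] by blast
  have verts: "norm (f (P - Z)) = 1" if "P \<in> {A, B, C, D}" for P
    using circ that unfolding circumscribed_def E2f by blast
  \<comment> \<open>The disc bounded by \<open>E2\<close> is convex and contains the vertices, hence the quadrilateral and \<open>E1\<close>.
    Scaling \<open>x\<close> onto the image of \<open>E1\<close> turns this into an inequality of forms.\<close>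
  have disc: "x \<bullet> x \<le> sym_form s r t x x" for x
  proof (cases "x = 0")
    case False
    have "convex ((+) Z ` (f -` cball 0 1))"
      by (intro convex_translation convex_linear_vimage f(1) convex_cball)
    moreover have "(+) Z ` (f -` cball 0 1) = {p. norm (f (p - Z)) \<le> 1}"
      by (auto simp: image_iff intro!: bexI[of _ "_ - Z"])
    ultimately have "convex {p. norm (f (p - Z)) \<le> 1}"
      by simp
    then have "convex hull {A, B, C, D} \<subseteq> {p. norm (f (p - Z)) \<le> 1}"
      using verts by (intro hull_minimal) (auto simp: less_imp_le)
    then have E1_disc: "norm (f (p - Z)) \<le> 1" if "p \<in> E1" for p
      using ins that unfolding inscribed_def by blast
    have "k x \<noteq> 0"
      using False f' g by (metis comp_apply k_def linear_0 linear_injective_0)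
    define y where "y = inverse (norm (k x)) *\<^sub>R x"
    have "norm (k y) = 1"
      using \<open>k x \<noteq> 0\<close> by (simp add: y_def linear_scale[OF k])
    then have "norm y \<le> 1"
      using E1_disc[of "Z + f' y"] by (simp add: E1g f' k_def)
    then have "norm x \<le> norm (k x)"
      using \<open>k x \<noteq> 0\<close> by (simp add: y_def field_simps)
    then have "x \<bullet> x \<le> k x \<bullet> k x"
      by (simp add: norm_le)
    then show ?thesis
      by (simp add: S)
  qed (simp add: sym_form_def)
  have side: "2 * sym_form s r t (f (P - Z)) (f (Q - Z))
      = (s + t - (s * t - r\<^sup>2)) * (1 + f (P - Z) \<bullet> f (Q - Z))"
    if PQ: "P \<in> {A, B, C, D}" "Q \<in> {A, B, C, D}" "P \<noteq> Q" and tan: "tangent_to_side E1 P Q" for P Q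
  proof -
    obtain p where "tangent_line_at (affine hull {P, Q}) E1 p"
      using tan unfolding tangent_to_side_def by blast
    then obtain w where w: "affine hull {P, Q} = {p + s *\<^sub>R w | s. True}"
      "norm (g (p - Z)) = 1" "g (p - Z) \<bullet> g w = 0"
      by (rule tangent_direction_conjugate[OF g(1) E1g])
    have "P \<in> affine hull {P, Q}" "Q \<in> affine hull {P, Q}"
      by (simp_all add: hull_inc)
    then obtain \<sigma> \<tau> where st: "P = p + \<sigma> *\<^sub>R w" "Q = p + \<tau> *\<^sub>R w"
      unfolding w(1) by blast
    have line: "f (p + c *\<^sub>R w - Z) = f (p - Z) + c *\<^sub>R f w" for c
      by (metis add_diff_eq add.commute diff_add_eq f(1) linear_add linear_scale)
    show ?thesis
    proof (rule chord_tangency_bilinear)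
      show "norm (f (P - Z)) = 1" "norm (f (Q - Z)) = 1"
        using verts PQ by blast+
      show "f (P - Z) \<noteq> f (Q - Z)"
        using PQ(3) injD[OF f(2)] by fastforce
      show "sym_form s r t (f (p - Z)) (f (p - Z)) = 1" "sym_form s r t (f (p - Z)) (f w) = 0"
        using w(2,3) by (simp_all add: S[symmetric] k_def f' norm_eq_1)
      show "f (P - Z) = f (p - Z) + \<sigma> *\<^sub>R f w" "f (Q - Z) = f (p - Z) + \<tau> *\<^sub>R f w"
        by (simp_all add: st line)
    qed
  qed
  have dist: "distinct [A, B, C, D]"
    using quad unfolding convex_quadrilateral_def by blast
  have f_neq: "f (P - Z) \<noteq> f (Q - Z)" if "P \<noteq> Q" for P Q
    using that injD[OF f(2)] by fastforce
  have tangents: "tangent_to_side E1 A B" "tangent_to_side E1 B C"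
    "tangent_to_side E1 C D" "tangent_to_side E1 D A"
    using ins unfolding inscribed_def by blast+
  have flip: "sym_form s r t x y = sym_form s r t y x" for x y
    by (simp add: sym_form_def algebra_simps)
  have chord: "2 * sym_form s r t (f (P - Z)) (f (Q - Z))
      = (s + t - (s * t - r\<^sup>2)) * (1 + f (P - Z) \<bullet> f (Q - Z))"
    if "P \<in> {A, C}" "Q \<in> {B, D}" for P Q
  proof -
    have "tangent_to_side E1 P Q \<or> tangent_to_side E1 Q P" "P \<noteq> Q"
      using that tangents dist by auto
    then show ?thesis
      using side[of P Q] side[of Q P] that
      by (metis flip inner_commute insertCI insertE singletonD)
  qed
  have "f (C - Z) = - f (A - Z)"
  proof (rule tangent_quadrilateral_diagonal_antipodal[OF disc])
    show "f (A - Z) \<noteq> f (C - Z)" "f (B - Z) \<noteq> f (D - Z)"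
      using dist by (auto intro!: f_neq)
    show "2 * sym_form s r t x y = (s + t - (s * t - r\<^sup>2)) * (1 + x \<bullet> y)"
      if "x \<in> {f (A - Z), f (C - Z)}" "y \<in> {f (B - Z), f (D - Z)}" for x y
      using that chord by blast
  qed (auto intro: verts)
  then have "f (C - Z) = f (- (A - Z))"
    by (simp only: linear_neg[OF f(1)])
  then have AC: "C - Z = - (A - Z)"
    using injD[OF f(2)] by blast
  have "f (D - Z) = - f (B - Z)"
  proof (rule tangent_quadrilateral_diagonal_antipodal[OF disc])
    show "f (B - Z) \<noteq> f (D - Z)" "f (A - Z) \<noteq> f (C - Z)"
      using dist by (auto intro!: f_neq)
    show "2 * sym_form s r t x y = (s + t - (s * t - r\<^sup>2)) * (1 + x \<bullet> y)"
      if "x \<in> {f (B - Z), f (D - Z)}" "y \<in> {f (A - Z), f (C - Z)}" for x y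
      using that chord by (subst flip, subst inner_commute) blast
  qed (auto intro: verts)
  then have "f (D - Z) = f (- (B - Z))"
    by (simp only: linear_neg[OF f(1)])
  then have BD: "D - Z = - (B - Z)"
    using injD[OF f(2)] by blast
  have "D - C = (-1) *\<^sub>R (B - A)" "A - D = (-1) *\<^sub>R (C - B)"
    using AC BD by (simp_all add: algebra_simps)
  then show ?thesis
    using quad unfolding parallelogram_def parallel_vectors_def collinear_lemma by blast
qed

theorem theorem3:
  fixes A B C D :: "real^2" and E1 E2 :: "(real^2) set"
  assumes "convex_quadrilateral A B C D"
    and "\<not> parallelogram A B C D"
    and "is_ellipse E1" and "is_ellipse E2"
    and "inscribed E1 A B C D"
    and "circumscribed E2 A B C D"
  shows "ellipse_center E1 \<noteq> ellipse_center E2"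
proof
  assume same: "ellipse_center E1 = ellipse_center E2"
  have "ellipse_centered_at (ellipse_center E) E" if "is_ellipse E" for E
    using that ellipse_center_eqI unfolding is_ellipse_def by blast
  then have "ellipse_centered_at (ellipse_center E2) E1" "ellipse_centered_at (ellipse_center E2) E2"
    using assms(3,4) same by metis+
  then show False
    using concentric_ellipses_imp_parallelogram assms by blast
qed

end
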